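(* Let $N\ge 1$, let $W\in\mathbb{R}^{N\times N}$ be a (row-)stochastic primitive matrix with $W_{ii}>0$ for all $i$, let $\{\lambda_t\}_{t\ge 0}$ be a sequence in $[0,1]$, let $x_0\in\mathbb{R}^N$, and let $\{x_t\}_{t\ge0}$ be generated by $$x_{t+1}=(1-\lambda_t)Wx_t+\lambda_t x_0,\qquad t\ge 0.$$ Let $v$ be the Perron eigenvector of $W$ and let $x_{\mathrm{ss}}:=v^\top x_0\in\mathbb{R}$. If $x_0\not\parallel\mathbf{1}$, then the following two statements are equivalent: 1) $\lim_{t\to\infty}\lambda_t=0$; 2) $\lim_{t\to\infty}x_t=x_{\mathrm{ss}}\mathbf{1}$.
   Context: $\mathbf{1}\in\mathbb{R}^N$ is the all-ones vector. A matrix $W$ is (row-)stochastic if all its entries are nonnegative and $W\mathbf{1}=\mathbf{1}$; it is primitive if there is $k\in\mathbb{N}$ such that all entries of $W^k$ are positive. The Perron eigenvector $v$ of a stochastic primitive matrix $W$ is the unique stochastic vector (nonnegative entries summing to $1$) with $W^\top v=v$. $x_0\not\parallel\mathbf{1}$ means that $x_0$ is not a scalar multiple of $\mathbf{1}$, i.e. $x_0\neq\alpha\mathbf{1}$ for every $\alpha\in\mathbb{R}$. *)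

theory Defs
  imports "HOL-Analysis.Analysis"
begin

(* On real^'n^'n the overloaded * and ^ act entrywise, so powers with respect to
   the matrix product are defined separately.  In contrast, the overloaded
   constant 1 :: real^'n is exactly the all-ones vector. *)
primrec mat_power :: "real^'n^'n \<Rightarrow> nat \<Rightarrow> real^'n^'n" where
  "mat_power A 0 = mat 1"
| "mat_power A (Suc k) = A ** mat_power A k"

definition stochastic_matrix :: "real^'n^'n \<Rightarrow> bool" where
  "stochastic_matrix W \<longleftrightarrow> (\<forall>i j. 0 \<le> W $ i $ j) \<and> W *v 1 = 1"

(* Exponents start at 1; for stochastic matrices, admitting k = 0 would change
   nothing, since the identity has a zero entry unless the dimension is 1. *)
definition primitive_matrix :: "real^'n^'n \<Rightarrow> bool" where
  "primitive_matrix W \<longleftrightarrow> (\<exists>k\<ge>1. \<forall>i j. 0 < mat_power W k $ i $ j)"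

definition stochastic_vector :: "real^'n \<Rightarrow> bool" where
  "stochastic_vector v \<longleftrightarrow> (\<forall>i. 0 \<le> v $ i) \<and> (\<Sum>i\<in>UNIV. v $ i) = 1"

(* Meaningful for stochastic primitive W, where Perron-Frobenius theory gives
   existence and uniqueness. *)
definition perron_vector :: "real^'n^'n \<Rightarrow> real^'n" where
  "perron_vector W = (THE v. stochastic_vector v \<and> transpose W *v v = v)"

end

theory Submission
  imports Defs
begin

text \<open>
  The Perron functional is conserved, \<open>v \<bullet> x t = v \<bullet> x0\<close>, so the errors \<open>x t - (v \<bullet> x0) 1\<close>
  stay in the hyperplane orthogonal to \<open>v\<close>.  There a positive power \<open>P\<close> of \<open>W\<close> is a strict
  contraction in the maximum norm: if all entries of \<open>P\<close> are at least \<open>d\<close>, subtracting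
  \<open>d (v \<bullet> e) 1 = 0\<close> from \<open>P e\<close> leaves nonnegative weights of total mass \<open>1 - d\<close>.  The terms
  involving \<open>lam\<close> are a vanishing perturbation of this contraction.  Brouwer's theorem on the
  simplex yields a fixed stochastic vector, and its uniqueness is the case \<open>lam = 0\<close> of the
  convergence result.  Conversely, if \<open>x t\<close> converges to any multiple of \<open>1\<close>, then in
  \<open>x (t + 1) - W x t = lam t (x0 - W x t)\<close> the left side vanishes in the limit while
  \<open>x0 - W x t\<close> does not.
\<close>

section \<open>Stochastic matrices and their powers\<close>

lemma stochastic_matrix_row_sum:
  assumes "stochastic_matrix W"
  shows "(\<Sum>j\<in>UNIV. W $ i $ j) = 1"
proof -
  have "(W *v 1) $ i = 1" using assms by (simp add: stochastic_matrix_def)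
  then show ?thesis by (simp add: matrix_vector_mult_def)
qed

lemma stochastic_matrix_mult:
  assumes "stochastic_matrix A" "stochastic_matrix B"
  shows "stochastic_matrix (A ** B)"
proof -
  have "(A ** B) *v 1 = 1"
    using assms by (simp add: stochastic_matrix_def flip: matrix_vector_mul_assoc)
  then show ?thesis
    using assms by (simp add: stochastic_matrix_def matrix_matrix_mult_def sum_nonneg)
qed

lemma stochastic_matrix_mat_power:
  fixes W :: "real^'n^'n"
  assumes "stochastic_matrix W"
  shows "stochastic_matrix (mat_power W k)"
proof (induction k)
  case 0
  have "mat 1 *v 1 = (1 :: real^'n)" by simp
  moreover have "0 \<le> (mat 1 :: real^'n^'n) $ i $ j" for i j by (simp add: mat_def)
  ultimately show ?case unfolding stochastic_matrix_def by simp
next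
  case (Suc k)
  then show ?case using assms by (simp add: stochastic_matrix_mult)
qed

section \<open>The invariant functional and maximum norm estimates\<close>

lemma inner_fixed_mult:
  fixes v :: "real^'n"
  assumes "transpose W *v v = v"
  shows "v \<bullet> (W *v y) = v \<bullet> y"
  by (metis assms dot_lmul_matrix transpose_matrix_vector)

lemma inner_stochastic_vector_one: "stochastic_vector v \<Longrightarrow> v \<bullet> 1 = 1"
  by (simp add: stochastic_vector_def inner_vec_def)

lemma infnorm_le_cart:
  fixes y :: "real^'n"
  assumes "\<And>i. \<bar>y $ i\<bar> \<le> b"
  shows "infnorm y \<le> b"
  unfolding infnorm_cart using assms by (intro cSup_least) auto

text \<open>Each entry of \<open>W *v y\<close> is a convex combination of the entries of
  \<open>y\<close>.\<close>

lemma infnorm_stochastic_mult_le: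
  assumes "stochastic_matrix W"
  shows "infnorm (W *v y) \<le> infnorm y"
proof (rule infnorm_le_cart)
  fix i
  have "\<bar>(W *v y) $ i\<bar> \<le> (\<Sum>j\<in>UNIV. \<bar>W $ i $ j * y $ j\<bar>)"
    by (simp add: matrix_vector_mult_def)
  also have "\<dots> \<le> (\<Sum>j\<in>UNIV. W $ i $ j * infnorm y)"
    using assms by (intro sum_mono)
      (auto simp: stochastic_matrix_def abs_mult intro!: mult_left_mono component_le_infnorm_cart)
  also have "\<dots> = infnorm y"
    using assms by (simp add: stochastic_matrix_row_sum flip: sum_distrib_right)
  finally show "\<bar>(W *v y) $ i\<bar> \<le> infnorm y" .
qed

lemma infnorm_positive_stochastic_mult_le:
  assumes P: "stochastic_matrix P" and v: "stochastic_vector v"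
    and d: "0 \<le> d" "\<And>i j. d \<le> P $ i $ j" and orth: "v \<bullet> y = 0"
  shows "infnorm (P *v y) \<le> (1 - d) * infnorm y"
proof (rule infnorm_le_cart)
  fix i
  have v1: "(\<Sum>j\<in>UNIV. v $ j) = 1" and v0: "\<And>j. 0 \<le> v $ j"
    using v by (auto simp: stochastic_vector_def)
  have vle: "v $ j \<le> 1" for j
    using member_le_sum[of j UNIV "\<lambda>j. v $ j"] v0 v1 by simp
  \<comment> \<open>From \<open>v $ j \<le> 1\<close> follows
    \<open>d * v $ j \<le> d \<le> P $ i $ j\<close>, so these differences can serve as
    weights.\<close>
  have nn: "0 \<le> P $ i $ j - d * v $ j" for j
    using d(2)[of i j] mult_left_mono[OF vle[of j] d(1)] by simp
  have "(\<Sum>j\<in>UNIV. v $ j * y $ j) = 0"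
    using orth by (simp add: inner_vec_def)
  then have "(P *v y) $ i = (\<Sum>j\<in>UNIV. (P $ i $ j - d * v $ j) * y $ j)"
    by (simp add: matrix_vector_mult_def left_diff_distrib sum_subtractf mult.assoc
        flip: sum_distrib_left)
  also have "\<bar>\<dots>\<bar> \<le> (\<Sum>j\<in>UNIV. \<bar>(P $ i $ j - d * v $ j) * y $ j\<bar>)"
    by (rule sum_abs)
  also have "\<dots> \<le> (\<Sum>j\<in>UNIV. (P $ i $ j - d * v $ j) * infnorm y)"
    using nn by (intro sum_mono) (auto simp: abs_mult intro!: mult_left_mono component_le_infnorm_cart)
  also have "\<dots> = (1 - d) * infnorm y"
    using P v1 by (simp add: stochastic_matrix_row_sum sum_subtractf
        flip: sum_distrib_right sum_distrib_left)
  finally show "\<bar>(P *v y) $ i\<bar> \<le> (1 - d) * infnorm y" .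
qed

section \<open>Convergence for vanishing weights\<close>

lemma perturbed_contraction_tendsto_0:
  fixes b :: "nat \<Rightarrow> real"
  assumes b: "\<And>t. 0 \<le> b t" "\<And>t. b t \<le> M" and q: "0 \<le> q" "q < 1"
    and step: "\<And>t. b (t + k) \<le> q * b t + r t" and r: "r \<longlonglongrightarrow> 0"
  shows "b \<longlonglongrightarrow> 0"
proof (rule LIMSEQ_I)
  fix h :: real assume "0 < h"
  define g where "g = h / 2"
  have g: "0 < g" using \<open>0 < h\<close> by (simp add: g_def)
  \<comment> \<open>Perturbations up to \<open>(1 - q) * g\<close> keep the level \<open>g\<close>
    invariant, since \<open>q * g + (1 - q) * g = g\<close>; only the excess over \<open>g\<close>
    decays geometrically.\<close>
  have "0 < (1 - q) * g" using q g by simp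
  then obtain T where T: "\<And>t. t \<ge> T \<Longrightarrow> r t \<le> (1 - q) * g"
    using LIMSEQ_D[OF r] by (metis abs_le_D1 diff_zero less_imp_le real_norm_def)
  have iter: "b (t + n * k) \<le> q ^ n * M + g" if "t \<ge> T" for t n
  proof (induction n)
    case 0
    show ?case using b(2)[of t] g by simp
  next
    case (Suc n)
    have "b (t + Suc n * k) \<le> q * b (t + n * k) + r (t + n * k)"
      using step[of "t + n * k"] by (simp add: algebra_simps)
    also have "\<dots> \<le> q * (q ^ n * M + g) + (1 - q) * g"
      using Suc T[of "t + n * k"] that q by (intro add_mono mult_left_mono) auto
    finally show ?case by (simp add: algebra_simps)
  qed
  have "(\<lambda>n. q ^ n * M) \<longlonglongrightarrow> 0"
    using q by (intro tendsto_mult_left_zero LIMSEQ_realpow_zero)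
  then obtain n where n: "q ^ n * M < g"
    using LIMSEQ_D[OF _ g] by (metis abs_le_D1 diff_zero abs_less_iff order_refl real_norm_def)
  \<comment> \<open>Every such \<open>s\<close> lies exactly \<open>n\<close> blocks of length
    \<open>k\<close> after some time past \<open>T\<close>. As \<open>iter\<close> holds from every
    starting time past \<open>T\<close>, all residues modulo \<open>k\<close> are covered at
    once.\<close>
  have "norm (b s - 0) < h" if "s \<ge> T + n * k" for s
  proof -
    have "s - n * k \<ge> T" "s - n * k + n * k = s" using that by auto
    then show ?thesis
      using iter[of "s - n * k" n] n b(1)[of s] by (simp add: g_def)
  qed
  then show "\<exists>no. \<forall>s\<ge>no. norm (b s - 0) < h" by blast
qed

text \<open>The contraction lives in the maximum norm, convergence in the Euclidean norm; in finite
  dimension the two are equivalent.\<close>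

lemma tendsto_of_infnorm_tendsto_0:
  fixes e :: "nat \<Rightarrow> 'a::euclidean_space"
  assumes "(\<lambda>t. infnorm (e t)) \<longlonglongrightarrow> 0"
  shows "e \<longlonglongrightarrow> 0"
proof (rule Lim_null_comparison)
  show "\<forall>\<^sub>F t in sequentially. norm (e t) \<le> sqrt DIM('a) * infnorm (e t)"
    by (simp add: norm_le_infnorm)
  show "(\<lambda>t. sqrt DIM('a) * infnorm (e t)) \<longlonglongrightarrow> 0"
    using tendsto_mult_right_zero[OF assms] .
qed

lemma orthogonal_iteration_tendsto_0:
  fixes W :: "real^'n^'n" and e :: "nat \<Rightarrow> real^'n"
  assumes W: "stochastic_matrix W" "primitive_matrix W"
    and v: "stochastic_vector v" "transpose W *v v = v"
    and lam: "\<And>t. lam t \<in> {0..1}" "lam \<longlonglongrightarrow> 0"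
    and step: "\<And>t. e (Suc t) = (1 - lam t) *\<^sub>R (W *v e t) + lam t *\<^sub>R e 0"
    and orth0: "v \<bullet> e 0 = 0"
  shows "e \<longlonglongrightarrow> 0"
proof -
  obtain k where k: "\<And>i j. 0 < mat_power W k $ i $ j"
    using W(2) by (auto simp: primitive_matrix_def)
  define P where "P = mat_power W k"
  define d where "d = Min (range (\<lambda>(i, j). P $ i $ j))"
  have dle: "d \<le> P $ i $ j" for i j
    unfolding d_def by (rule Min_le) (auto intro: image_eqI[of _ _ "(i, j)"])
  have d0: "0 < d"
    using k by (simp add: d_def P_def split_beta)
  have P: "stochastic_matrix P"
    using W(1) by (simp add: P_def stochastic_matrix_mat_power)
  \<comment> \<open>Ensures that the contraction factor \<open>1 - d\<close> is nonnegative.\<close>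
  have d1: "d \<le> 1"
  proof -
    fix i :: 'n
    have "P $ i $ i \<le> 1"
      using member_le_sum[of i UNIV "\<lambda>j. P $ i $ j"] stochastic_matrix_row_sum[OF P, of i] P
      by (simp add: stochastic_matrix_def)
    then show ?thesis using dle[of i i] by simp
  qed
  define M where "M = infnorm (e 0)"
  have M0: "0 \<le> M" by (simp add: M_def infnorm_pos_le)
  have orth: "v \<bullet> e t = 0" for t
    by (induction t) (simp_all add: orth0 step inner_add_right inner_fixed_mult[OF v(2)])
  have bound: "infnorm (e t) \<le> M" for t
  proof (induction t)
    case 0
    show ?case by (simp add: M_def)
  next
    case (Suc t)
    have "infnorm (e (Suc t)) \<le> (1 - lam t) * infnorm (W *v e t) + lam t * M"
      using infnorm_triangle[of "(1 - lam t) *\<^sub>R (W *v e t)" "lam t *\<^sub>R e 0"] lam(1)[of t]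
      by (simp add: step infnorm_mul M_def)
    also have "\<dots> \<le> (1 - lam t) * M + lam t * M"
      using Suc infnorm_stochastic_mult_le[OF W(1), of "e t"] lam(1)[of t]
      by (intro add_mono mult_left_mono) auto
    finally show ?case by (simp add: algebra_simps)
  qed
  \<comment> \<open>Compares \<open>e\<close> with the unperturbed orbit restarted from
    \<open>e t\<close>. Each step adds an error of at most \<open>2 * M\<close> times the current
    weight, and \<open>W\<close> does not amplify earlier errors. For fixed \<open>m\<close> the
    bound vanishes as \<open>t\<close> grows.\<close>
  have drift: "infnorm (e (t + m) - mat_power W m *v e t) \<le> (\<Sum>j<m. 2 * M * lam (t + j))" for t m
  proof (induction m)
    case 0
    show ?case by (simp add: infnorm_0)
  next
    case (Suc m)
    let ?f = "e (t + m) - mat_power W m *v e t" and ?g = "e 0 - W *v e (t + m)"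
    have "e (t + Suc m) - mat_power W (Suc m) *v e t = W *v ?f + lam (t + m) *\<^sub>R ?g"
      by (simp add: step matrix_vector_mult_diff_distrib algebra_simps flip: matrix_vector_mul_assoc)
    then have "infnorm (e (t + Suc m) - mat_power W (Suc m) *v e t)
        \<le> infnorm (W *v ?f) + lam (t + m) * infnorm ?g"
      using infnorm_triangle[of "W *v ?f" "lam (t + m) *\<^sub>R ?g"] lam(1)[of "t + m"]
      by (simp add: infnorm_mul)
    also have "\<dots> \<le> (\<Sum>j<m. 2 * M * lam (t + j)) + lam (t + m) * (2 * M)"
    proof (intro add_mono mult_left_mono)
      show "infnorm (W *v ?f) \<le> (\<Sum>j<m. 2 * M * lam (t + j))"
        using infnorm_stochastic_mult_le[OF W(1), of ?f] Suc by simp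
      show "infnorm ?g \<le> 2 * M"
        using infnorm_triangle[of "e 0" "- (W *v e (t + m))"] bound[of "t + m"]
          infnorm_stochastic_mult_le[OF W(1), of "e (t + m)"]
        by (simp add: infnorm_neg M_def)
    qed (use lam(1)[of "t + m"] in simp)
    finally show ?case by (simp add: mult.commute)
  qed
  have "(\<lambda>t. infnorm (e t)) \<longlonglongrightarrow> 0"
  proof (rule perturbed_contraction_tendsto_0)
    show "infnorm (e (t + k)) \<le> (1 - d) * infnorm (e t) + (\<Sum>j<k. 2 * M * lam (t + j))" for t
      using infnorm_triangle[of "P *v e t" "e (t + k) - P *v e t"] drift[of t k]
        infnorm_positive_stochastic_mult_le[OF P v(1) less_imp_le[OF d0] dle orth, of t]
      by (simp add: P_def)
    have "(\<lambda>t. \<Sum>j<k. 2 * M * lam (t + j)) \<longlonglongrightarrow> (\<Sum>j<k. 2 * M * 0)"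
      by (intro tendsto_sum tendsto_mult_left LIMSEQ_ignore_initial_segment lam(2))
    then show "(\<lambda>t. \<Sum>j<k. 2 * M * lam (t + j)) \<longlonglongrightarrow> 0" by simp
  qed (use d0 d1 bound in \<open>auto simp: infnorm_pos_le\<close>)
  then show ?thesis by (rule tendsto_of_infnorm_tendsto_0)
qed

text \<open>Subtracting a multiple of 1 preserves the recursion, because \<open>W\<close> fixes 1
  and the two weights sum to 1. The vector \<open>v\<close> is any fixed stochastic vector rather
  than \<open>perron_vector W\<close>, because the uniqueness behind that definite description is
  itself derived from this convergence.\<close>

lemma anchored_iteration_tendsto:
  fixes W :: "real^'n^'n" and x :: "nat \<Rightarrow> real^'n"
  assumes W: "stochastic_matrix W" "primitive_matrix W"
    and v: "stochastic_vector v" "transpose W *v v = v"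
    and lam: "\<And>t. lam t \<in> {0..1}" "lam \<longlonglongrightarrow> 0"
    and step: "\<And>t. x (Suc t) = (1 - lam t) *\<^sub>R (W *v x t) + lam t *\<^sub>R x 0"
  shows "x \<longlonglongrightarrow> (v \<bullet> x 0) *\<^sub>R 1"
proof -
  define e where "e t = x t - (v \<bullet> x 0) *\<^sub>R 1" for t
  have W1: "W *v 1 = 1"
    using W(1) by (simp add: stochastic_matrix_def)
  have "e \<longlonglongrightarrow> 0"
  proof (rule orthogonal_iteration_tendsto_0[OF W v lam])
    show "e (Suc t) = (1 - lam t) *\<^sub>R (W *v e t) + lam t *\<^sub>R e 0" for t
      by (simp add: e_def step matrix_vector_mult_diff_distrib matrix_vector_mult_scaleR W1 algebra_simps)
    show "v \<bullet> e 0 = 0"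
      by (simp add: e_def inner_diff_right inner_stochastic_vector_one[OF v(1)])
  qed
  then show ?thesis unfolding e_def [abs_def] by (rule LIM_zero_cancel)
qed

section \<open>Existence and uniqueness of the Perron vector\<close>

lemma stochastic_fixed_vector_exists:
  fixes W :: "real^'n^'n"
  assumes "stochastic_matrix W"
  obtains v where "stochastic_vector v" "transpose W *v v = v"
proof -
  define S :: "(real^'n) set" where "S = {v. stochastic_vector v}"
  have S_eq: "S = (\<Inter>i. {v. 0 \<le> v $ i}) \<inter> {v. (\<Sum>i\<in>UNIV. v $ i) = 1}"
    by (auto simp: S_def stochastic_vector_def)
  have "closed S"
    unfolding S_eq by (intro closed_Int closed_INT ballI closed_Collect_le closed_Collect_eq continuous_intros)
  moreover have "bounded S"
  proof (rule boundedI)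
    fix v assume "v \<in> S"
    then show "norm v \<le> 1"
      using norm_le_l1_cart[of v] by (simp add: S_def stochastic_vector_def)
  qed
  ultimately have "compact S" by (simp add: compact_eq_bounded_closed)
  moreover have "convex S"
    by (rule convexI)
      (auto simp: S_def stochastic_vector_def sum.distrib simp flip: sum_distrib_left)
  moreover have "S \<noteq> {}"
  proof -
    \<comment> \<open>A vertex of the simplex; \<open>undefined\<close> merely names some
      index.\<close>
    have "axis undefined 1 \<in> S"
      by (simp add: S_def stochastic_vector_def axis_def)
    then show ?thesis by blast
  qed
  moreover have "continuous_on S ((*v) (transpose W))"
    by (intro linear_continuous_on matrix_vector_mul_bounded_linear)
  moreover have "(*v) (transpose W) \<in> S \<rightarrow> S"
  proof
    fix v assume v: "v \<in> S"
    \<comment> \<open>Total mass is the pairing with 1, so it is preserved by duality with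
      \<open>W *v 1 = 1\<close>.\<close>
    have "(\<Sum>i\<in>UNIV. (transpose W *v v) $ i) = (transpose W *v v) \<bullet> 1"
      by (simp add: inner_vec_def)
    also have "\<dots> = v \<bullet> (W *v 1)"
      by (simp add: transpose_matrix_vector dot_lmul_matrix)
    also have "\<dots> = 1"
      using assms v by (simp add: S_def stochastic_matrix_def inner_stochastic_vector_one)
    finally have "(\<Sum>i\<in>UNIV. (transpose W *v v) $ i) = 1" .
    moreover have "0 \<le> (transpose W *v v) $ i" for i
      using assms v
      by (auto simp: S_def stochastic_matrix_def stochastic_vector_def matrix_vector_mult_def
          transpose_def intro!: sum_nonneg)
    ultimately show "transpose W *v v \<in> S"
      by (simp add: S_def stochastic_vector_def)
  qed
  ultimately obtain v where "v \<in> S" "transpose W *v v = v"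
    by (rule brouwer)
  then show thesis by (intro that) (auto simp: S_def)
qed

lemma stochastic_fixed_vector_unique:
  fixes W :: "real^'n^'n"
  assumes W: "stochastic_matrix W" "primitive_matrix W"
    and v: "stochastic_vector v" "transpose W *v v = v"
    and w: "stochastic_vector w" "transpose W *v w = w"
  shows "v = w"
proof -
  have "v \<bullet> y = w \<bullet> y" for y
  proof -
    \<comment> \<open>The limit of this orbit determines \<open>u \<bullet> y\<close> for every
      fixed stochastic vector \<open>u\<close>, so all such \<open>u\<close> induce the same
      functional.\<close>
    define x where "x t = ((*v) W ^^ t) y" for t
    have "x \<longlonglongrightarrow> (u \<bullet> x 0) *\<^sub>R 1" if "stochastic_vector u" "transpose W *v u = u" for u
      by (rule anchored_iteration_tendsto[OF W that, where lam = "\<lambda>_. 0"]) (auto simp: x_def)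
    then have "(v \<bullet> x 0) *\<^sub>R (1::real^'n) = (w \<bullet> x 0) *\<^sub>R 1"
      using v w LIMSEQ_unique by blast
    then show ?thesis by (simp add: x_def)
  qed
  then show ?thesis by (metis vector_eq_rdot)
qed

lemma perron_vector_fixed:
  fixes W :: "real^'n^'n"
  assumes "stochastic_matrix W" "primitive_matrix W"
  shows "stochastic_vector (perron_vector W)" "transpose W *v perron_vector W = perron_vector W"
proof -
  obtain v where v: "stochastic_vector v" "transpose W *v v = v"
    using stochastic_fixed_vector_exists[OF assms(1)] .
  then have "perron_vector W = v"
    unfolding perron_vector_def
    by (intro the_equality) (auto intro: stochastic_fixed_vector_unique[OF assms])
  with v show "stochastic_vector (perron_vector W)"
    "transpose W *v perron_vector W = perron_vector W"
    by simp_all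
qed

section \<open>Convergence forces the weights to vanish\<close>

lemma anchor_weights_tendsto_0:
  fixes W :: "real^'n^'n" and x :: "nat \<Rightarrow> real^'n"
  assumes W: "W *v 1 = 1"
    and step: "\<And>t. x (Suc t) = (1 - lam t) *\<^sub>R (W *v x t) + lam t *\<^sub>R x0"
    and lim: "x \<longlonglongrightarrow> c *\<^sub>R 1" and x0: "x0 \<noteq> c *\<^sub>R 1"
  shows "lam \<longlonglongrightarrow> 0"
proof -
  have "(\<lambda>t. W *v x t) \<longlonglongrightarrow> W *v (c *\<^sub>R 1)"
    by (intro isCont_tendsto_compose[OF _ lim]) (simp add: linear_continuous_at linear_linear)
  then have Wlim: "(\<lambda>t. W *v x t) \<longlonglongrightarrow> c *\<^sub>R 1"
    by (simp add: matrix_vector_mult_scaleR W)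
  have den: "(\<lambda>t. norm (x0 - W *v x t)) \<longlonglongrightarrow> norm (x0 - c *\<^sub>R 1)"
    by (intro tendsto_intros Wlim)
  have num: "(\<lambda>t. norm (x (Suc t) - W *v x t)) \<longlonglongrightarrow> norm (c *\<^sub>R 1 - c *\<^sub>R (1::real^'n))"
    by (intro tendsto_intros Wlim LIMSEQ_Suc lim)
  have pos: "0 < norm (x0 - c *\<^sub>R 1)" using x0 by simp
  have "(\<lambda>t. norm (x (Suc t) - W *v x t) / norm (x0 - W *v x t)) \<longlonglongrightarrow> 0"
    using tendsto_divide[OF num den] pos by simp
  \<comment> \<open>The denominator may vanish for some early \<open>t\<close>; it is positive
    eventually because its limit is, and from then on the quotient recovers the weight.\<close>
  moreover have "\<forall>\<^sub>F t in sequentially.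
      norm (x (Suc t) - W *v x t) / norm (x0 - W *v x t) = \<bar>lam t\<bar>"
    using order_tendstoD(1)[OF den pos]
  proof eventually_elim
    case (elim t)
    have "x (Suc t) - W *v x t = lam t *\<^sub>R (x0 - W *v x t)"
      by (simp add: step algebra_simps)
    then show ?case using elim by simp
  qed
  ultimately have "(\<lambda>t. \<bar>lam t\<bar>) \<longlonglongrightarrow> 0"
    by (rule Lim_transform_eventually)
  then show ?thesis by (simp add: tendsto_rabs_zero_iff)
qed

theorem theorem1:
  fixes W :: "real^'n^'n"
    and lam :: "nat \<Rightarrow> real"
    and x :: "nat \<Rightarrow> real^'n"
    and x0 :: "real^'n"
  assumes "stochastic_matrix W"
    and "primitive_matrix W"
    and "\<And>i. 0 < W $ i $ i"
    and "\<And>t. lam t \<in> {0..1}"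
    and "x 0 = x0"
    and "\<And>t. x (Suc t) = (1 - lam t) *\<^sub>R (W *v x t) + lam t *\<^sub>R x0"
    and "\<And>a::real. x0 \<noteq> a *\<^sub>R 1"
  shows "(lam \<longlonglongrightarrow> 0) \<longleftrightarrow> (x \<longlonglongrightarrow> (perron_vector W \<bullet> x0) *\<^sub>R 1)"
proof
  assume "lam \<longlonglongrightarrow> 0"
  then show "x \<longlonglongrightarrow> (perron_vector W \<bullet> x0) *\<^sub>R 1"
    using anchored_iteration_tendsto[OF assms(1,2) perron_vector_fixed[OF assms(1,2)], of lam x] assms(4-6)
    by simp
next
  assume "x \<longlonglongrightarrow> (perron_vector W \<bullet> x0) *\<^sub>R 1"
  then show "lam \<longlonglongrightarrow> 0"
    using anchor_weights_tendsto_0[of W x lam x0] assms by (auto simp: stochastic_matrix_def)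
qed

end
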